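(* Let $X$ be a finite simplicial complex with connected 1-skeleton $G=(V,E)$ having at least one edge, let $T=(V,E_T)$ be a spanning tree of $G$ with root node $v_r$, and let $Z=\{\gamma(T,e): e\in E\setminus E_T\}$ be the associated set of 1-cycles. Let $y$ be a harmonic generated as the limit $y=\lim_{k\to\infty}y^k$ of the iteration $y^{k+1}=y^k-\delta L_1y^k$, where $y^0\in\mathbb{R}^{|E|}$ is a random vector with independent entries uniformly distributed on $[-0.5,0.5]$ and $0<\delta<2/\lambda$ for every positive eigenvalue $\lambda$ of $L_1$. Let $c_1,c_2\in Z$. Then, with probability 1, $c_1$ is homologous to $c_2$ (meaning that $c_1+c_2\in B$ or $c_1-c_2\in B$, where $B=\mathrm{Img}(\partial_2)$) if and only if $$|\langle y,c_1\rangle|=|\langle y,c_2\rangle|.$$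
   Context: For $i=0,1,2$, $C_i$ is the real vector space with basis the $i$-simplices of $X$, each given a fixed arbitrary orientation by an ordering of its vertices (the oppositely oriented simplex is the additive inverse). The boundary operators are $\partial_i(v_{j_0},\ldots,v_{j_i})=\sum_{l=0}^{i}(-1)^l(v_{j_0},\ldots,\hat v_{j_l},\ldots,v_{j_i})$, identified with their matrices in the standard bases, so $C_1=\mathbb{R}^{|E|}$. The first combinatorial Laplacian is $L_1=\partial_2\partial_2^T+\partial_1^T\partial_1$; elements of $\ker(L_1)$ are called harmonics. $\langle\cdot,\cdot\rangle$ is the standard dot product on $C_1$. For a path $p=(e_{i_1}\cdots e_{i_k})$ in $G$, $\pi(p)=\sum_{j=1}^k\alpha_j\sigma_j\in C_1$, where $\sigma_j$ is the standard basis element supported on the edge $e_{i_j}$, and $\alpha_j=1$ if $\sigma_j$ has the same orientation as the direction in which the path traverses $e_{i_j}$, and $\alpha_j=-1$ otherwise. For $e=(v_1,v_2)\in E\setminus E_T$, let $p_1$ be the path in $T$ from $v_r$ to $v_1$ and $p_2$ the path in $T$ from $v_2$ to $v_r$; then $\gamma(T,e)=\pi(p_1,e,p_2)\in\ker(\partial_1)$. *)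

theory Defs
  imports "HOL-Probability.Probability" "HOL-Combinatorics.Permutations"
begin

section \<open>Graphs\<close>

text \<open>A simple graph is given by a vertex set \<open>V\<close> and a set \<open>E\<close> of two-element subsets of \<open>V\<close>.
  A walk is given by its list of vertices, which determines its edges.\<close>

definition walk :: "'v set \<Rightarrow> 'v set set \<Rightarrow> 'v list \<Rightarrow> bool" where
  "walk V E p \<longleftrightarrow> p \<noteq> [] \<and> set p \<subseteq> V \<and> successively (\<lambda>u v. {u, v} \<in> E) p"

definition simple_path :: "'v set \<Rightarrow> 'v set set \<Rightarrow> 'v \<Rightarrow> 'v \<Rightarrow> 'v list \<Rightarrow> bool" where
  "simple_path V E u v p \<longleftrightarrow> walk V E p \<and> distinct p \<and> hd p = u \<and> last p = v"

definition graph_connected :: "'v set \<Rightarrow> 'v set set \<Rightarrow> bool" where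
  "graph_connected V E \<longleftrightarrow>
     V \<noteq> {} \<and> (\<forall>u\<in>V. \<forall>v\<in>V. \<exists>p. walk V E p \<and> hd p = u \<and> last p = v)"

definition graph_cycle :: "'v set \<Rightarrow> 'v set set \<Rightarrow> 'v list \<Rightarrow> bool" where
  "graph_cycle V E p \<longleftrightarrow> walk V E p \<and> distinct p \<and> length p \<ge> 3 \<and> {last p, hd p} \<in> E"

definition graph_tree :: "'v set \<Rightarrow> 'v set set \<Rightarrow> bool" where
  "graph_tree V E \<longleftrightarrow> graph_connected V E \<and> (\<nexists>p. graph_cycle V E p)"

definition spanning_tree :: "'v set \<Rightarrow> 'v set set \<Rightarrow> 'v set set \<Rightarrow> bool" where
  "spanning_tree V E E\<^sub>T \<longleftrightarrow> E\<^sub>T \<subseteq> E \<and> graph_tree V E\<^sub>T"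

definition tree_path :: "'v set \<Rightarrow> 'v set set \<Rightarrow> 'v \<Rightarrow> 'v \<Rightarrow> 'v list" where
  "tree_path V E\<^sub>T u v = (THE p. simple_path V E\<^sub>T u v p)"

section \<open>Oriented simplicial complexes and their chains\<close>

definition finite_simplicial_complex :: "'v set set \<Rightarrow> bool" where
  "finite_simplicial_complex X \<longleftrightarrow>
     finite X \<and> (\<forall>\<sigma>\<in>X. finite \<sigma> \<and> \<sigma> \<noteq> {}) \<and> (\<forall>\<sigma>\<in>X. \<forall>\<tau>. \<tau> \<subseteq> \<sigma> \<and> \<tau> \<noteq> {} \<longrightarrow> \<tau> \<in> X)"

definition simplices :: "'v set set \<Rightarrow> nat \<Rightarrow> 'v set set" where
  "simplices X i = {\<sigma> \<in> X. card \<sigma> = i + 1}"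

definition vertices :: "'v set set \<Rightarrow> 'v set" where
  "vertices X = {v. {v} \<in> X}"

abbreviation edges :: "'v set set \<Rightarrow> 'v set set" where
  "edges X \<equiv> simplices X 1"

definition orientation :: "'v set set \<Rightarrow> ('v set \<Rightarrow> 'v list) \<Rightarrow> bool" where
  "orientation X ori \<longleftrightarrow>
     (\<forall>i\<le>2. \<forall>\<sigma>\<in>simplices X i. distinct (ori \<sigma>) \<and> set (ori \<sigma>) = \<sigma>)"

text \<open>A chain is given by its coefficients with respect to the standard basis, whose elements are
  the simplices \<open>\<sigma>\<close> with the orientation \<open>ori \<sigma>\<close>.\<close>

type_synonym 'v chain = "'v set \<Rightarrow> real"

definition chain_space :: "'v set set \<Rightarrow> nat \<Rightarrow> 'v chain set" where
  "chain_space X i = {c. \<forall>\<sigma>. \<sigma> \<notin> simplices X i \<longrightarrow> c \<sigma> = 0}"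

definition reorder_sign :: "'v list \<Rightarrow> 'v list \<Rightarrow> real" where
  "reorder_sign xs ys =
     of_int (sign (THE p. p permutes {..<length ys} \<and> permute_list p ys = xs))"

text \<open>The oriented simplex \<open>(v\<^sub>0, \<dots>, v\<^sub>i)\<close> as a chain: plus or minus the basis element on the same
  vertices, according to the parity of the reordering.\<close>

definition oriented_simplex :: "('v set \<Rightarrow> 'v list) \<Rightarrow> 'v list \<Rightarrow> 'v chain" where
  "oriented_simplex ori xs = (\<lambda>\<sigma>. if \<sigma> = set xs then reorder_sign xs (ori \<sigma>) else 0)"

definition omit_nth :: "nat \<Rightarrow> 'v list \<Rightarrow> 'v list" where
  "omit_nth l xs = take l xs @ drop (Suc l) xs"

text \<open>The entry of the matrix of the boundary operator in row \<open>\<tau>\<close> and column \<open>\<sigma>\<close>.\<close>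

definition boundary_matrix :: "('v set \<Rightarrow> 'v list) \<Rightarrow> 'v set \<Rightarrow> 'v set \<Rightarrow> real" where
  "boundary_matrix ori \<tau> \<sigma> =
     (\<Sum>l<length (ori \<sigma>). (-1) ^ l * oriented_simplex ori (omit_nth l (ori \<sigma>)) \<tau>)"

text \<open>The operators \<open>\<partial>\<^sub>i\<close> and their transposes, for \<open>i \<ge> 1\<close>.\<close>

definition boundary :: "'v set set \<Rightarrow> ('v set \<Rightarrow> 'v list) \<Rightarrow> nat \<Rightarrow> 'v chain \<Rightarrow> 'v chain" where
  "boundary X ori i c =
     (\<lambda>\<tau>. if \<tau> \<in> simplices X (i - 1)
          then \<Sum>\<sigma>\<in>simplices X i. boundary_matrix ori \<tau> \<sigma> * c \<sigma> else 0)"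

definition boundary_transpose ::
    "'v set set \<Rightarrow> ('v set \<Rightarrow> 'v list) \<Rightarrow> nat \<Rightarrow> 'v chain \<Rightarrow> 'v chain" where
  "boundary_transpose X ori i c =
     (\<lambda>\<sigma>. if \<sigma> \<in> simplices X i
          then \<Sum>\<tau>\<in>simplices X (i - 1). boundary_matrix ori \<tau> \<sigma> * c \<tau> else 0)"

definition laplacian1 :: "'v set set \<Rightarrow> ('v set \<Rightarrow> 'v list) \<Rightarrow> 'v chain \<Rightarrow> 'v chain" where
  "laplacian1 X ori c =
     (\<lambda>e. boundary X ori 2 (boundary_transpose X ori 2 c) e
        + boundary_transpose X ori 1 (boundary X ori 1 c) e)"

definition laplacian1_eigenvalue :: "'v set set \<Rightarrow> ('v set \<Rightarrow> 'v list) \<Rightarrow> real \<Rightarrow> bool" where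
  "laplacian1_eigenvalue X ori \<mu> \<longleftrightarrow>
     (\<exists>c\<in>chain_space X 1. c \<noteq> (\<lambda>_. 0) \<and> laplacian1 X ori c = (\<lambda>e. \<mu> * c e))"

definition harmonics :: "'v set set \<Rightarrow> ('v set \<Rightarrow> 'v list) \<Rightarrow> 'v chain set" where
  "harmonics X ori = {c \<in> chain_space X 1. laplacian1 X ori c = (\<lambda>_. 0)}"

definition inner1 :: "'v set set \<Rightarrow> 'v chain \<Rightarrow> 'v chain \<Rightarrow> real" where
  "inner1 X a b = (\<Sum>e\<in>edges X. a e * b e)"

definition boundaries1 :: "'v set set \<Rightarrow> ('v set \<Rightarrow> 'v list) \<Rightarrow> 'v chain set" where
  "boundaries1 X ori = boundary X ori 2 ` chain_space X 2"

definition homologous :: "'v set set \<Rightarrow> ('v set \<Rightarrow> 'v list) \<Rightarrow> 'v chain \<Rightarrow> 'v chain \<Rightarrow> bool" where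
  "homologous X ori a b \<longleftrightarrow>
     (\<lambda>e. a e + b e) \<in> boundaries1 X ori \<or> (\<lambda>e. a e - b e) \<in> boundaries1 X ori"

section \<open>The cycles of a spanning tree\<close>

definition path_chain :: "('v set \<Rightarrow> 'v list) \<Rightarrow> 'v list \<Rightarrow> 'v chain" where
  "path_chain ori p =
     (\<lambda>e. \<Sum>j<length p - 1.
        if e = {p ! j, p ! Suc j} then (if ori e = [p ! j, p ! Suc j] then 1 else -1) else 0)"

text \<open>The edge \<open>e\<close> is traversed in the direction of its orientation, from \<open>v\<^sub>1\<close> to \<open>v\<^sub>2\<close>. Appending
  the vertex list of \<open>p\<^sub>2\<close>, which starts at \<open>v\<^sub>2\<close>, to that of \<open>p\<^sub>1\<close>, which ends at \<open>v\<^sub>1\<close>, inserts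
  exactly the step along \<open>e\<close>.\<close>

definition tree_cycle ::
    "'v set set \<Rightarrow> ('v set \<Rightarrow> 'v list) \<Rightarrow> 'v set set \<Rightarrow> 'v \<Rightarrow> 'v set \<Rightarrow> 'v chain" where
  "tree_cycle X ori E\<^sub>T r e =
     (let v1 = ori e ! 0; v2 = ori e ! 1;
          p1 = tree_path (vertices X) E\<^sub>T r v1; p2 = tree_path (vertices X) E\<^sub>T v2 r
      in path_chain ori (p1 @ p2))"

definition tree_cycles ::
    "'v set set \<Rightarrow> ('v set \<Rightarrow> 'v list) \<Rightarrow> 'v set set \<Rightarrow> 'v \<Rightarrow> 'v chain set" where
  "tree_cycles X ori E\<^sub>T r = tree_cycle X ori E\<^sub>T r ` (edges X - E\<^sub>T)"

section \<open>The iteration\<close>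

primrec laplacian_iter ::
    "'v set set \<Rightarrow> ('v set \<Rightarrow> 'v list) \<Rightarrow> real \<Rightarrow> 'v chain \<Rightarrow> nat \<Rightarrow> 'v chain" where
  "laplacian_iter X ori \<delta> y0 0 = y0"
| "laplacian_iter X ori \<delta> y0 (Suc k) =
     (\<lambda>e. laplacian_iter X ori \<delta> y0 k e - \<delta> * laplacian1 X ori (laplacian_iter X ori \<delta> y0 k) e)"

lemma tendsto_laplacian1:
  assumes "\<And>e. (\<lambda>k. f k e) \<longlonglongrightarrow> y e"
  shows "(\<lambda>k. laplacian1 X ori (f k) e) \<longlonglongrightarrow> laplacian1 X ori y e"
  unfolding laplacian1_def boundary_def boundary_transpose_def
  by (auto intro!: tendsto_intros assms)

text \<open>Limits of the iteration are automatically harmonic.\<close>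

lemma laplacian_iter_limit_harmonic:
  assumes "\<delta> > 0" "y0 \<in> chain_space X 1"
    and lim: "\<And>e. (\<lambda>k. laplacian_iter X ori \<delta> y0 k e) \<longlonglongrightarrow> y e"
  shows "y \<in> harmonics X ori"
proof -
  have "laplacian1 X ori y e = 0" for e
  proof -
    have "(\<lambda>k. laplacian_iter X ori \<delta> y0 (Suc k) e) \<longlonglongrightarrow> y e - \<delta> * laplacian1 X ori y e"
      by (auto intro!: tendsto_intros lim tendsto_laplacian1)
    moreover have "(\<lambda>k. laplacian_iter X ori \<delta> y0 (Suc k) e) \<longlonglongrightarrow> y e"
      using lim[of e] by (rule LIMSEQ_Suc)
    ultimately have "y e - \<delta> * laplacian1 X ori y e = y e"
      by (rule LIMSEQ_unique)
    with assms(1) show ?thesis by simp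
  qed
  moreover have "y e = 0" if "e \<notin> edges X" for e
  proof -
    have "laplacian_iter X ori \<delta> y0 k e = 0" for k
      using that assms(2)
      by (induction k) (auto simp: chain_space_def laplacian1_def boundary_def boundary_transpose_def)
    with lim[of e] show ?thesis by (simp add: LIMSEQ_const_iff)
  qed
  ultimately show ?thesis by (auto simp: harmonics_def chain_space_def)
qed

end

theory Submission
  imports Defs
begin

text \<open>Let \<open>c\<close> be \<open>c1 + c2\<close> or \<open>c1 - c2\<close>, a cycle. Splitting off its orthogonal projection to the boundaries gives
  \<open>c = h + \<partial>\<^sub>2 x\<close> with \<open>h\<close> harmonic, because \<open>\<partial>\<^sub>1 \<partial>\<^sub>2 = 0\<close>. A harmonic \<open>y\<close> is orthogonal to the
  boundaries, so \<open>\<langle>y, c\<rangle> = \<langle>y, h\<rangle>\<close>, and as the Laplacian is self-adjoint, every step of the iteration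
  preserves the product with \<open>h\<close>, so \<open>\<langle>y, h\<rangle> = \<langle>y0, h\<rangle>\<close>. If \<open>c\<close> is not a boundary then \<open>h \<noteq> 0\<close>, and a
  nonzero linear form in independent random variables with atomless distributions is almost surely
  nonzero.\<close>

section \<open>Paths in trees\<close>

text \<open>Cutting out the closed stretch between two occurrences of a repeated vertex shortens the
  walk and keeps both ends, so induction on the length applies.\<close>

lemma walk_imp_simple_path:
  assumes "walk V E p"
  obtains q where "simple_path V E (hd p) (last p) q"
proof -
  have "\<exists>q. simple_path V E (hd p) (last p) q"
    using assms
  proof (induction p rule: length_induct)
    case (1 p)
    show ?case
    proof (cases "distinct p")
      case True
      with 1 show ?thesis by (auto simp: simple_path_def)
    next
      case False
      then obtain xs ys zs a where p: "p = xs @ [a] @ ys @ [a] @ zs"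
        using not_distinct_decomp by blast
      let ?p = "xs @ [a] @ zs"
      have "walk V E ?p"
        using "1.prems" unfolding walk_def p
        by (auto simp: successively_append_iff successively_Cons)
      moreover have "length ?p < length p" "hd ?p = hd p" "last ?p = last p"
        by (simp_all add: p hd_append)
      ultimately show ?thesis using "1.IH" by metis
    qed
  qed
  with that show thesis by blast
qed

lemma walk_Cons:
  "p \<noteq> [] \<Longrightarrow> walk V E (u # p) \<longleftrightarrow> u \<in> V \<and> {u, hd p} \<in> E \<and> walk V E p"
  by (auto simp: walk_def successively_Cons)

lemma walk_append:
  assumes "walk V E p" "walk V E q" "{last p, hd q} \<in> E"
  shows "walk V E (p @ q)"
  using assms by (auto simp: walk_def successively_append_iff)

lemma walk_nth:
  assumes "walk V E p" "j < length p - 1"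
  shows "{p ! j, p ! Suc j} \<in> E"
  using assms successively_nth[of "\<lambda>u v. {u, v} \<in> E" p j] by (simp add: walk_def)

text \<open>Two simple paths that part at \<open>u\<close> close up to a cycle at the first vertex of one that
  lies on the other.\<close>

lemma fork_imp_graph_cycle:
  assumes p: "simple_path V E u v (u # p)" and q: "simple_path V E u v (u # q)"
    and "p \<noteq> []" "q \<noteq> []" "hd p \<noteq> hd q"
  shows "\<exists>c. graph_cycle V E c"
proof -
  have "last p = v" "last q = v" using assms by (auto simp: simple_path_def)
  hence "v \<in> set p" "v \<in> set q" using assms(3,4) last_in_set by metis+
  then obtain p1 x p2 where p12: "p = p1 @ x # p2" and "x \<in> set q" and p1: "\<forall>y\<in>set p1. y \<notin> set q"
    using split_list_first_prop[of p "\<lambda>x. x \<in> set q"] by blast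
  then obtain q1 q2 where q12: "q = q1 @ x # q2" by (meson split_list)
  let ?c = "u # p1 @ x # rev q1"
  have "distinct ?c"
    using p q p1 unfolding simple_path_def p12 q12 by auto
  \<comment> \<open>\<open>p1\<close> and \<open>q1\<close> cannot both be empty, since then
    \<open>hd p = x = hd q\<close>.\<close>
  moreover have "length ?c \<ge> 3"
    using assms(5) unfolding p12 q12 by (cases p1; cases q1) auto
  moreover have "{last ?c, hd ?c} \<in> E"
    using q unfolding simple_path_def q12 walk_def
    by (cases q1) (auto simp: successively_Cons insert_commute last_rev)
  moreover have "walk V E ?c"
  proof -
    have "successively (\<lambda>u v. {u, v} \<in> E) (q1 @ [x])"
      using q unfolding simple_path_def q12 walk_def
      by (auto simp: successively_append_iff successively_Cons)
    hence "successively (\<lambda>u v. {u, v} \<in> E) (x # rev q1)"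
      using successively_rev[of "\<lambda>u v. {u, v} \<in> E" "q1 @ [x]"] by (simp add: insert_commute)
    moreover have "successively (\<lambda>u v. {u, v} \<in> E) ((u # p1) @ x # p2)"
      using p unfolding simple_path_def p12 walk_def by simp
    ultimately have "successively (\<lambda>u v. {u, v} \<in> E) ((u # p1) @ x # rev q1)"
      unfolding successively_append_iff by simp
    moreover have "set ?c \<subseteq> V"
      using p q unfolding simple_path_def p12 q12 walk_def by auto
    ultimately show ?thesis by (simp add: walk_def)
  qed
  ultimately show ?thesis unfolding graph_cycle_def by blast
qed

text \<open>Without cycles there is no fork, so both paths take the same first step, and the
  induction continues with their tails.\<close>

lemma simple_path_unique:
  assumes "\<nexists>c. graph_cycle V E c" "simple_path V E u v p" "simple_path V E u v q"
  shows "p = q"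
  using assms(2,3)
proof (induction p arbitrary: u q)
  case Nil
  thus ?case by (simp add: simple_path_def walk_def)
next
  case (Cons a p)
  from Cons.prems have [simp]: "a = u" by (simp add: simple_path_def)
  from Cons.prems obtain q' where q: "q = u # q'"
    by (cases q) (auto simp: simple_path_def walk_def)
  \<comment> \<open>If one path is just \<open>[u]\<close>, then \<open>u = v\<close>, and
    distinctness keeps the other from returning to \<open>u\<close>.\<close>
  consider "p = []" | "q' = []" | "p \<noteq> []" "q' \<noteq> []" by blast
  thus ?case
  proof cases
    case 3
    then have "hd p = hd q'"
      using fork_imp_graph_cycle[of V E u v p q'] assms(1) Cons.prems q by auto
    moreover from this have "simple_path V E (hd p) v p" "simple_path V E (hd p) v q'"
      using Cons.prems 3 unfolding q by (auto simp: simple_path_def walk_Cons)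
    ultimately show ?thesis using Cons.IH q by simp
  qed (use Cons.prems q in \<open>auto simp: simple_path_def split: if_splits\<close>)
qed

text \<open>Connectedness gives existence and acyclicity uniqueness, so the definite description in
  \<open>tree_path\<close> denotes an actual path.\<close>

lemma simple_path_tree_path:
  assumes "graph_tree V E" "u \<in> V" "v \<in> V"
  shows "simple_path V E u v (tree_path V E u v)"
proof -
  obtain p where "simple_path V E u v p"
    using assms walk_imp_simple_path unfolding graph_tree_def graph_connected_def by metis
  moreover have "q = q'" if "simple_path V E u v q" "simple_path V E u v q'" for q q'
    using assms(1) that simple_path_unique unfolding graph_tree_def by metis
  ultimately have "\<exists>!p. simple_path V E u v p" by auto
  thus ?thesis unfolding tree_path_def by (rule theI')
qed

section \<open>Boundaries\<close>

text \<open>The permutation described in \<open>reorder_sign\<close> is unique: distinct entries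
  determine it on the positions of \<open>ys\<close>, and elsewhere it is the identity.\<close>

lemma reorder_sign_permute_list:
  assumes "distinct ys" "p permutes {..<length ys}"
  shows "reorder_sign (permute_list p ys) ys = of_int (sign p)"
proof -
  have "q = p" if q: "q permutes {..<length ys}" "permute_list q ys = permute_list p ys" for q
  proof
    fix i
    show "q i = p i"
    proof (cases "i < length ys")
      case True
      hence "ys ! q i = ys ! p i"
        using q assms(2) permute_list_nth by metis
      moreover have "q i < length ys" "p i < length ys"
        using permutes_in_image[OF q(1)] permutes_in_image[OF assms(2)] True by auto
      ultimately show ?thesis using assms(1) by (simp add: nth_eq_iff_index_eq)
    next
      case False
      with q(1) assms(2) show ?thesis by (simp add: permutes_not_in)
    qed
  qed
  with assms(2) show ?thesis unfolding reorder_sign_def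
    by (intro arg_cong[of _ _ "\<lambda>p. of_int (sign p)"] the_equality) auto
qed

lemma reorder_sign_refl: "distinct xs \<Longrightarrow> reorder_sign xs xs = 1"
  using reorder_sign_permute_list[of xs id] by (simp add: permutes_id)

lemma reorder_sign_swap: "a \<noteq> b \<Longrightarrow> reorder_sign [a, b] [b, a] = -1"
  using reorder_sign_permute_list[of "[b, a]" "Transposition.transpose 0 1"]
  by (simp add: permutes_swap_id sign_swap_id permute_list_def)

section \<open>Oriented simplices of dimension at most two\<close>

lemma orientation_edge:
  assumes "orientation X ori" "e \<in> edges X"
  obtains a b where "ori e = [a, b]" "a \<noteq> b" "e = {a, b}"
proof -
  have "distinct (ori e)" "set (ori e) = e"
    using assms unfolding orientation_def by (meson one_le_numeral)+
  moreover from this have "length (ori e) = 2"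
    using assms(2) distinct_card[of "ori e"] by (simp add: simplices_def)
  ultimately show thesis
    using that by (auto simp: length_Suc_conv numeral_2_eq_2)
qed

lemma orientation_triangle:
  assumes "orientation X ori" "\<sigma> \<in> simplices X 2"
  obtains a b c where "ori \<sigma> = [a, b, c]" "distinct [a, b, c]" "\<sigma> = {a, b, c}"
proof -
  have d: "distinct (ori \<sigma>)" "set (ori \<sigma>) = \<sigma>" using assms by (auto simp: orientation_def)
  hence "length (ori \<sigma>) = 3"
    using assms(2) distinct_card[of "ori \<sigma>"] by (simp add: simplices_def)
  then obtain a b c where "ori \<sigma> = [a, b, c]"
    by (auto simp: length_Suc_conv numeral_3_eq_3)
  with d that show thesis by auto
qed

lemma oriented_simplex_vertex:
  assumes "orientation X ori" "{a} \<in> X"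
  shows "oriented_simplex ori [a] = (\<lambda>\<tau>. of_bool (\<tau> = {a}))"
proof -
  have "distinct (ori {a})" "set (ori {a}) = {a}"
    using assms by (auto simp: orientation_def simplices_def)
  moreover from this have "length (ori {a}) = 1"
    using distinct_card[of "ori {a}"] by simp
  ultimately have "ori {a} = [a]" by (auto simp: length_Suc_conv)
  thus ?thesis by (auto simp: oriented_simplex_def reorder_sign_refl)
qed

text \<open>Two vertices have only two orderings, so the sign of the reordering becomes the case
  distinction used in \<open>path_chain\<close>.\<close>

lemma oriented_simplex_edge:
  assumes "orientation X ori" "{a, b} \<in> edges X"
  shows "oriented_simplex ori [a, b] =
    (\<lambda>e. if e = {a, b} then (if ori e = [a, b] then 1 else -1) else 0)"
proof -
  obtain c d where cd: "ori {a, b} = [c, d]" "c \<noteq> d" "{a, b} = {c, d}"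
    using orientation_edge[OF assms] .
  hence "c = a \<and> d = b \<or> c = b \<and> d = a" by (auto simp: doubleton_eq_iff)
  thus ?thesis
    using cd reorder_sign_swap[of a b]
    by (auto simp: oriented_simplex_def reorder_sign_refl fun_eq_iff)
qed

lemma simplicial_complex_face:
  assumes "finite_simplicial_complex X" "\<sigma> \<in> X" "\<tau> \<subseteq> \<sigma>" "\<tau> \<noteq> {}"
  shows "\<tau> \<in> X"
  using assms unfolding finite_simplicial_complex_def by blast

lemma finite_simplices: "finite_simplicial_complex X \<Longrightarrow> finite (simplices X i)"
  by (simp add: finite_simplicial_complex_def simplices_def)

lemma boundary_matrix_edge:
  assumes "finite_simplicial_complex X" "orientation X ori" "e \<in> edges X" "ori e = [a, b]"
  shows "boundary_matrix ori \<tau> e = of_bool (\<tau> = {b}) - of_bool (\<tau> = {a})"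
proof -
  obtain c d where "ori e = [c, d]" "e = {c, d}"
    using orientation_edge[OF assms(2,3)] .
  hence "e = {a, b}" using assms(4) by simp
  hence "{a} \<in> X" "{b} \<in> X"
    using assms(1,3) simplicial_complex_face[of X e] by (auto simp: simplices_def)
  thus ?thesis using assms(2,4)
    by (simp add: boundary_matrix_def omit_nth_def oriented_simplex_vertex lessThan_Suc
        numeral_2_eq_2)
qed

text \<open>The result does not depend on how \<open>ori\<close> stores the edge: reversing it
  changes the sign of both the coefficient and the matrix column.\<close>

lemma boundary_oriented_edge:
  assumes "finite_simplicial_complex X" "orientation X ori" "{a, b} \<in> edges X"
  shows "boundary X ori 1 (oriented_simplex ori [a, b]) =
    (\<lambda>\<tau>. of_bool (\<tau> = {b}) - of_bool (\<tau> = {a}))"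
proof
  fix \<tau>
  have ab: "{a} \<in> simplices X 0" "{b} \<in> simplices X 0"
    using assms(1,3) simplicial_complex_face[of X "{a, b}"] by (auto simp: simplices_def)
  show "boundary X ori 1 (oriented_simplex ori [a, b]) \<tau> = of_bool (\<tau> = {b}) - of_bool (\<tau> = {a})"
  proof (cases "\<tau> \<in> simplices X 0")
    case True
    hence "boundary X ori 1 (oriented_simplex ori [a, b]) \<tau> =
      (\<Sum>e\<in>edges X. boundary_matrix ori \<tau> e * oriented_simplex ori [a, b] e)"
      by (simp add: boundary_def)
    also have "\<dots> = boundary_matrix ori \<tau> {a, b} * oriented_simplex ori [a, b] {a, b}"
      using assms(3) finite_simplices[OF assms(1)]
      by (subst sum.remove[where x = "{a, b}"]) (auto simp: oriented_simplex_def intro!: sum.neutral)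
    also have "\<dots> = of_bool (\<tau> = {b}) - of_bool (\<tau> = {a})"
    proof -
      obtain c d where cd: "ori {a, b} = [c, d]" "c \<noteq> d" "{a, b} = {c, d}"
        using orientation_edge[OF assms(2,3)] .
      hence "c = a \<and> d = b \<or> c = b \<and> d = a" by (auto simp: doubleton_eq_iff)
      thus ?thesis
        using cd boundary_matrix_edge[OF assms cd(1)]
        by (auto simp: oriented_simplex_edge[OF assms(2,3)])
    qed
    finally show ?thesis .
  qed (use ab in \<open>auto simp: boundary_def\<close>)
qed

section \<open>Linearity, the chain complex property and adjointness\<close>

lemma boundary_add:
  "boundary X ori i (\<lambda>\<sigma>. c \<sigma> + d \<sigma>) =
    (\<lambda>\<tau>. boundary X ori i c \<tau> + boundary X ori i d \<tau>)"
  by (auto simp: boundary_def algebra_simps sum.distrib)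

lemma boundary_scale: "boundary X ori i (\<lambda>\<sigma>. k * c \<sigma>) = (\<lambda>\<tau>. k * boundary X ori i c \<tau>)"
  by (auto simp: boundary_def sum_distrib_left algebra_simps)

lemma boundary_diff:
  "boundary X ori i (\<lambda>\<sigma>. c \<sigma> - d \<sigma>) =
    (\<lambda>\<tau>. boundary X ori i c \<tau> - boundary X ori i d \<tau>)"
  by (auto simp: boundary_def algebra_simps sum_subtractf)

lemma boundary_sum:
  "boundary X ori i (\<lambda>\<sigma>. \<Sum>j\<in>J. c j \<sigma>) =
    (\<lambda>\<tau>. \<Sum>j\<in>J. boundary X ori i (c j) \<tau>)"
  unfolding boundary_def sum_distrib_left by (rule ext) (auto intro: sum.swap)

lemma boundary_matrix_triangle:
  assumes "ori \<sigma> = [a, b, c]"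
  shows "boundary_matrix ori e \<sigma> =
    oriented_simplex ori [b, c] e - oriented_simplex ori [a, c] e + oriented_simplex ori [a, b] e"
  using assms by (simp add: boundary_matrix_def omit_nth_def lessThan_Suc numeral_3_eq_3)

text \<open>By linearity it suffices to treat the column of one triangle, where the end points of
  the three edges cancel in pairs.\<close>

lemma boundary_boundary:
  assumes "finite_simplicial_complex X" "orientation X ori"
  shows "boundary X ori 1 (boundary X ori 2 c) = (\<lambda>_. 0)"
proof -
  have tri: "boundary X ori 1 (\<lambda>e. boundary_matrix ori e \<sigma>) = (\<lambda>_. 0)"
    and supp: "\<And>e. e \<notin> edges X \<Longrightarrow> boundary_matrix ori e \<sigma> = 0" if \<sigma>: "\<sigma> \<in> simplices X 2" for \<sigma>
  proof -
    obtain u v w where o: "ori \<sigma> = [u, v, w]" "distinct [u, v, w]" "\<sigma> = {u, v, w}"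
      using orientation_triangle[OF assms(2) \<sigma>] .
    have f: "{u, v} \<in> edges X" "{u, w} \<in> edges X" "{v, w} \<in> edges X"
      using simplicial_complex_face[OF assms(1), of \<sigma>] o \<sigma> by (auto simp: simplices_def)
    note bm = boundary_matrix_triangle[of ori \<sigma> u v w, OF o(1)]
    show "boundary X ori 1 (\<lambda>e. boundary_matrix ori e \<sigma>) = (\<lambda>_. 0)"
      unfolding bm boundary_add boundary_diff
        boundary_oriented_edge[OF assms f(1)] boundary_oriented_edge[OF assms f(2)]
        boundary_oriented_edge[OF assms f(3)] by simp
    show "boundary_matrix ori e \<sigma> = 0" if "e \<notin> edges X" for e
      using that f unfolding bm
      by (auto simp: oriented_simplex_def)
  qed
  \<comment> \<open>\<open>boundary\<close> is cut off outside \<open>edges X\<close>; by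
    \<open>supp\<close> the columns vanish there anyway, so a plain linear combination of columns
    remains.\<close>
  have "boundary X ori 2 c = (\<lambda>e. \<Sum>\<sigma>\<in>simplices X 2. c \<sigma> * boundary_matrix ori e \<sigma>)"
    using supp by (auto simp: boundary_def mult.commute intro!: sum.neutral)
  thus ?thesis by (simp add: boundary_sum boundary_scale tri del: One_nat_def)
qed

lemma boundary_adjoint:
  "(\<Sum>\<tau>\<in>simplices X (i - 1). boundary X ori i a \<tau> * b \<tau>) =
   (\<Sum>\<sigma>\<in>simplices X i. a \<sigma> * boundary_transpose X ori i b \<sigma>)"
proof -
  have "(\<Sum>\<tau>\<in>simplices X (i - 1). boundary X ori i a \<tau> * b \<tau>) =
    (\<Sum>\<tau>\<in>simplices X (i - 1). \<Sum>\<sigma>\<in>simplices X i. boundary_matrix ori \<tau> \<sigma> * a \<sigma> * b \<tau>)"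
    by (auto simp: boundary_def sum_distrib_right)
  also have "\<dots> = (\<Sum>\<sigma>\<in>simplices X i. \<Sum>\<tau>\<in>simplices X (i - 1). boundary_matrix ori \<tau> \<sigma> * a \<sigma> * b \<tau>)"
    by (rule sum.swap)
  also have "\<dots> = (\<Sum>\<sigma>\<in>simplices X i. a \<sigma> * boundary_transpose X ori i b \<sigma>)"
    by (auto simp: boundary_transpose_def sum_distrib_left mult_ac)
  finally show ?thesis .
qed

section \<open>Tree cycles\<close>

lemma edge_subset_vertices:
  assumes "finite_simplicial_complex X" "e \<in> edges X"
  shows "e \<subseteq> vertices X"
  using simplicial_complex_face[OF assms(1), of e] assms(2) by (auto simp: vertices_def simplices_def)

lemma path_chain_walk:
  assumes "orientation X ori" "walk (vertices X) (edges X) p"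
  shows "path_chain ori p = (\<lambda>e. \<Sum>j<length p - 1. oriented_simplex ori [p ! j, p ! Suc j] e)"
proof -
  have "{p ! j, p ! Suc j} \<in> edges X" if "j < length p - 1" for j
    using assms(2) that walk_nth by blast
  thus ?thesis
    unfolding path_chain_def by (auto simp: oriented_simplex_edge[OF assms(1)] intro!: sum.cong)
qed

text \<open>Every step contributes its end minus its start, and the sum telescopes. In particular,
  closed walks give cycles.\<close>

lemma boundary_path_chain:
  assumes "finite_simplicial_complex X" "orientation X ori" "walk (vertices X) (edges X) p"
  shows "boundary X ori 1 (path_chain ori p) = (\<lambda>\<tau>. of_bool (\<tau> = {last p}) - of_bool (\<tau> = {hd p}))"
proof -
  have "{p ! j, p ! Suc j} \<in> edges X" if "j < length p - 1" for j
    using assms(3) that walk_nth by blast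
  hence "boundary X ori 1 (path_chain ori p) \<tau> =
      (\<Sum>j<length p - 1. of_bool (\<tau> = {p ! Suc j}) - of_bool (\<tau> = {p ! j}))" for \<tau>
    unfolding path_chain_walk[OF assms(2,3)] boundary_sum
    by (intro sum.cong) (simp_all add: boundary_oriented_edge[OF assms(1,2)] del: One_nat_def)
  also have "\<dots> \<tau> = of_bool (\<tau> = {p ! (length p - 1)}) - of_bool (\<tau> = {p ! 0})" for \<tau>
    by (rule sum_lessThan_telescope)
  finally show ?thesis
    using assms(3) by (simp add: walk_def last_conv_nth hd_conv_nth fun_eq_iff)
qed

lemma path_chain_in_chain_space:
  assumes "walk (vertices X) (edges X) p"
  shows "path_chain ori p \<in> chain_space X 1"
proof -
  have "{p ! j, p ! Suc j} \<in> edges X" if "j < length p - 1" for j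
    using assms that walk_nth by blast
  thus ?thesis unfolding chain_space_def path_chain_def by (auto intro!: sum.neutral)
qed

text \<open>The vertex list is a closed walk from \<open>r\<close> to \<open>r\<close>, so the two
  boundary terms cancel.\<close>

lemma tree_cycles_are_cycles:
  assumes "finite_simplicial_complex X" "orientation X ori"
    and "spanning_tree (vertices X) (edges X) E\<^sub>T" "r \<in> vertices X"
    and "c \<in> tree_cycles X ori E\<^sub>T r"
  shows "c \<in> chain_space X 1" "boundary X ori 1 c = (\<lambda>_. 0)"
proof -
  obtain e where e: "e \<in> edges X" and c: "c = tree_cycle X ori E\<^sub>T r e"
    using assms(5) by (auto simp: tree_cycles_def)
  obtain a b where ab: "ori e = [a, b]" "a \<noteq> b" "e = {a, b}"
    using orientation_edge[OF assms(2) e] .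
  define p where "p = tree_path (vertices X) E\<^sub>T r a"
  define q where "q = tree_path (vertices X) E\<^sub>T b r"
  have "a \<in> vertices X" "b \<in> vertices X"
    using edge_subset_vertices[OF assms(1) e] ab by auto
  hence *: "simple_path (vertices X) E\<^sub>T r a p" "simple_path (vertices X) E\<^sub>T b r q"
    using assms(3,4) simple_path_tree_path unfolding p_def q_def spanning_tree_def by metis+
  have "E\<^sub>T \<subseteq> edges X" using assms(3) by (simp add: spanning_tree_def)
  hence "walk (vertices X) (edges X) p'" if "walk (vertices X) E\<^sub>T p'" for p'
    using that unfolding walk_def by (auto elim: successively_mono)
  \<comment> \<open>The step joining the end of \<open>p\<close> to the start of \<open>q\<close> is
    the edge \<open>e\<close> itself.\<close>
  hence w: "walk (vertices X) (edges X) (p @ q)"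
    using * e ab by (intro walk_append) (auto simp: simple_path_def)
  have "c = path_chain ori (p @ q)"
    using ab by (simp add: c tree_cycle_def p_def q_def)
  moreover have "hd (p @ q) = r" "last (p @ q) = r"
    using * by (auto simp: simple_path_def walk_def)
  ultimately show "c \<in> chain_space X 1" "boundary X ori 1 c = (\<lambda>_. 0)"
    using path_chain_in_chain_space[OF w] boundary_path_chain[OF assms(1,2) w] by auto
qed

section \<open>Harmonic representatives\<close>

text \<open>Gram-Schmidt by induction on \<open>T\<close>; the vectors \<open>B t\<close> may be
  linearly dependent. For a new vector \<open>B u\<close>, the residuals of \<open>c\<close> and
  \<open>B u\<close> modulo the old span are formed, and from the first its component along the
  second is removed.\<close>

lemma orthogonal_projection_on_span:
  fixes B :: "'t \<Rightarrow> 'i \<Rightarrow> real" and c :: "'i \<Rightarrow> real"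
  assumes "finite I" "finite T"
  obtains x where "\<And>t. t \<in> T \<Longrightarrow> (\<Sum>i\<in>I. (c i - (\<Sum>s\<in>T. x s * B s i)) * B t i) = 0"
proof -
  have "\<exists>x. \<forall>t\<in>T. (\<Sum>i\<in>I. (c i - (\<Sum>s\<in>T. x s * B s i)) * B t i) = 0" for c :: "'i \<Rightarrow> real"
    using assms(2)
  proof (induction T arbitrary: c)
    case (insert u T)
    obtain x where x: "\<forall>t\<in>T. (\<Sum>i\<in>I. (c i - (\<Sum>s\<in>T. x s * B s i)) * B t i) = 0"
      using insert.IH by blast
    obtain z where z: "\<forall>t\<in>T. (\<Sum>i\<in>I. (B u i - (\<Sum>s\<in>T. z s * B s i)) * B t i) = 0"
      using insert.IH by blast
    define c' where "c' = (\<lambda>i. c i - (\<Sum>s\<in>T. x s * B s i))"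
    define B' where "B' = (\<lambda>i. B u i - (\<Sum>s\<in>T. z s * B s i))"
    \<comment> \<open>If the residual \<open>B'\<close> is zero on \<open>I\<close>, the quotient is
      0 by convention, and orthogonality to \<open>B'\<close> is trivial.\<close>
    define k where "k = (\<Sum>i\<in>I. c' i * B' i) / (\<Sum>i\<in>I. B' i * B' i)"
    define d where "d = (\<lambda>i. c' i - k * B' i)"
    have dT: "(\<Sum>i\<in>I. d i * B t i) = 0" if "t \<in> T" for t
    proof -
      have "(\<Sum>i\<in>I. d i * B t i) = (\<Sum>i\<in>I. c' i * B t i) - k * (\<Sum>i\<in>I. B' i * B t i)"
        by (simp add: d_def algebra_simps sum_subtractf sum_distrib_left)
      thus ?thesis using x z that by (simp add: c'_def B'_def)
    qed
    have dB': "(\<Sum>i\<in>I. d i * B' i) = 0"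
    proof (cases "(\<Sum>i\<in>I. B' i * B' i) = 0")
      case True
      hence "B' i = 0" if "i \<in> I" for i
        using that assms(1) by (subst (asm) sum_nonneg_eq_0_iff) auto
      thus ?thesis by simp
    next
      case False
      have "(\<Sum>i\<in>I. d i * B' i) = (\<Sum>i\<in>I. c' i * B' i) - k * (\<Sum>i\<in>I. B' i * B' i)"
        by (simp add: d_def algebra_simps sum_subtractf sum_distrib_left)
      with False show ?thesis by (simp add: k_def)
    qed
    \<comment> \<open>\<open>B u\<close> is \<open>B'\<close> plus a combination of the old vectors,
      and \<open>d\<close> is orthogonal to all of these.\<close>
    have "(\<Sum>i\<in>I. d i * B u i) = (\<Sum>i\<in>I. d i * B' i + (\<Sum>s\<in>T. z s * (d i * B s i)))"
      by (simp add: B'_def algebra_simps sum_distrib_left)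
    also have "\<dots> = (\<Sum>i\<in>I. d i * B' i) + (\<Sum>s\<in>T. z s * (\<Sum>i\<in>I. d i * B s i))"
      unfolding sum_distrib_left sum.distrib by (simp add: sum.swap[of _ I T])
    also have "\<dots> = 0" using dB' dT by simp
    finally have du: "(\<Sum>i\<in>I. d i * B u i) = 0" .
    \<comment> \<open>The coefficients are collected from \<open>c - d\<close>, which is the
      projection of \<open>c\<close> plus \<open>k\<close> times \<open>B u\<close> minus its
      projection.\<close>
    let ?w = "\<lambda>s. if s = u then k else x s - k * z s"
    have "c i - (\<Sum>s\<in>insert u T. ?w s * B s i) = d i" for i
    proof -
      have "(\<Sum>s\<in>T. ?w s * B s i) = (\<Sum>s\<in>T. x s * B s i) - k * (\<Sum>s\<in>T. z s * B s i)"
        using insert.hyps unfolding sum_distrib_left sum_subtractf[symmetric]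
        by (intro sum.cong) (auto simp: algebra_simps)
      thus ?thesis using insert.hyps by (simp add: d_def c'_def B'_def algebra_simps)
    qed
    with dT du show ?case by (intro exI[of _ ?w]) simp
  qed simp
  with that show thesis by blast
qed

text \<open>Both summands of the Laplacian have the form of an operator times its adjoint. The
  right-hand side is a sum of squares for \<open>b = a\<close>, and it vanishes whenever
  \<open>b\<close> is killed by both operators.\<close>

lemma inner1_laplacian1:
  "inner1 X (laplacian1 X ori a) b =
    (\<Sum>\<sigma>\<in>simplices X 2. boundary_transpose X ori 2 a \<sigma> * boundary_transpose X ori 2 b \<sigma>)
    + (\<Sum>v\<in>simplices X 0. boundary X ori 1 a v * boundary X ori 1 b v)"
proof -
  have "inner1 X (laplacian1 X ori a) b =
     (\<Sum>e\<in>edges X. boundary X ori 2 (boundary_transpose X ori 2 a) e * b e) +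
     (\<Sum>e\<in>edges X. b e * boundary_transpose X ori 1 (boundary X ori 1 a) e)"
    by (simp add: inner1_def laplacian1_def algebra_simps sum.distrib)
  thus ?thesis
    using boundary_adjoint[of X ori 2 "boundary_transpose X ori 2 a" b]
      boundary_adjoint[of X ori 1 b "boundary X ori 1 a"]
    by (simp add: mult.commute)
qed

text \<open>The product of \<open>y\<close> with its Laplacian is a sum of squares equal to 0, so
  each square vanishes.\<close>

lemma harmonic_imp_cocycle:
  assumes "finite_simplicial_complex X" "y \<in> harmonics X ori"
  shows "boundary_transpose X ori 2 y = (\<lambda>_. 0)"
proof
  fix \<sigma>
  let ?t = "boundary_transpose X ori 2 y"
  have "inner1 X (laplacian1 X ori y) y = 0"
    using assms(2) by (simp add: harmonics_def inner1_def)
  hence "(\<Sum>\<sigma>\<in>simplices X 2. ?t \<sigma> * ?t \<sigma>) + (\<Sum>v\<in>simplices X 0. boundary X ori 1 y v * boundary X ori 1 y v) = 0"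
    by (simp add: inner1_laplacian1)
  hence "(\<Sum>\<sigma>\<in>simplices X 2. ?t \<sigma> * ?t \<sigma>) = 0"
    using sum_nonneg[of "simplices X 2" "\<lambda>\<sigma>. ?t \<sigma> * ?t \<sigma>"]
      sum_nonneg[of "simplices X 0" "\<lambda>v. boundary X ori 1 y v * boundary X ori 1 y v"]
    by auto
  hence "\<forall>\<sigma>\<in>simplices X 2. ?t \<sigma> = 0"
    using finite_simplices[OF assms(1)] by (subst (asm) sum_nonneg_eq_0_iff) auto
  thus "?t \<sigma> = 0" by (cases "\<sigma> \<in> simplices X 2") (auto simp: boundary_transpose_def)
qed

lemma inner1_add_right: "inner1 X y (\<lambda>e. a e + b e) = inner1 X y a + inner1 X y b"
  and inner1_diff_right: "inner1 X y (\<lambda>e. a e - b e) = inner1 X y a - inner1 X y b"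
  by (simp_all add: inner1_def algebra_simps sum.distrib sum_subtractf)

lemma inner1_harmonic_boundary:
  assumes "finite_simplicial_complex X" "y \<in> harmonics X ori"
  shows "inner1 X y (boundary X ori 2 x) = 0"
  using boundary_adjoint[of X ori 2 x y] harmonic_imp_cocycle[OF assms]
  by (simp add: inner1_def mult.commute)

text \<open>Hodge decomposition of a cycle: being orthogonal to the columns of the second boundary
  matrix means being killed by its transpose. Harmonicity of \<open>h\<close> is stated as two
  separate equations, the form in which the iteration uses it.\<close>

lemma cycle_homologous_to_harmonic:
  assumes "finite_simplicial_complex X" "orientation X ori"
    and "c \<in> chain_space X 1" "boundary X ori 1 c = (\<lambda>_. 0)"
  obtains h x where "x \<in> chain_space X 2" "c = (\<lambda>e. h e + boundary X ori 2 x e)"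
    "h \<in> chain_space X 1" "boundary X ori 1 h = (\<lambda>_. 0)" "boundary_transpose X ori 2 h = (\<lambda>_. 0)"
proof -
  obtain x0 where x0: "\<And>\<sigma>. \<sigma> \<in> simplices X 2 \<Longrightarrow>
      (\<Sum>e\<in>edges X. (c e - (\<Sum>s\<in>simplices X 2. x0 s * boundary_matrix ori e s)) * boundary_matrix ori e \<sigma>) = 0"
    using orthogonal_projection_on_span[OF finite_simplices[OF assms(1)] finite_simplices[OF assms(1)],
        where c = c and B = "\<lambda>\<sigma> e. boundary_matrix ori e \<sigma>"] by blast
  \<comment> \<open>The projection leaves the coefficients outside the triangles arbitrary; they are
    set to 0 to obtain a chain.\<close>
  define x where "x = (\<lambda>\<sigma>. if \<sigma> \<in> simplices X 2 then x0 \<sigma> else 0)"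
  define h where "h = (\<lambda>e. c e - boundary X ori 2 x e)"
  have "x \<in> chain_space X 2" by (simp add: x_def chain_space_def)
  moreover have "c = (\<lambda>e. h e + boundary X ori 2 x e)" by (simp add: h_def)
  moreover have "h \<in> chain_space X 1"
    using assms(3) by (simp add: chain_space_def h_def boundary_def)
  moreover have "boundary X ori 1 h = (\<lambda>_. 0)"
    unfolding h_def boundary_diff by (simp add: assms boundary_boundary del: One_nat_def)
  moreover have "boundary_transpose X ori 2 h = (\<lambda>_. 0)"
  proof -
    have "(\<Sum>e\<in>edges X. boundary_matrix ori e \<sigma> * h e) = 0" if "\<sigma> \<in> simplices X 2" for \<sigma>
      using x0[OF that] by (simp add: h_def boundary_def x_def mult.commute)
    thus ?thesis by (auto simp: boundary_transpose_def)
  qed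
  ultimately show thesis by (rule that)
qed

text \<open>Each step subtracts a multiple of a Laplacian, whose product with \<open>h\<close> is 0
  by \<open>inner1_laplacian1\<close>.\<close>

lemma inner1_laplacian_iter:
  assumes "boundary X ori 1 h = (\<lambda>_. 0)" "boundary_transpose X ori 2 h = (\<lambda>_. 0)"
  shows "inner1 X (laplacian_iter X ori \<delta> y0 k) h = inner1 X y0 h"
proof (induction k)
  case (Suc k)
  let ?z = "laplacian_iter X ori \<delta> y0 k"
  have "inner1 X (laplacian_iter X ori \<delta> y0 (Suc k)) h =
      inner1 X ?z h - \<delta> * inner1 X (laplacian1 X ori ?z) h"
    by (simp add: inner1_def algebra_simps sum_subtractf sum_distrib_left)
  thus ?case using Suc by (simp add: inner1_laplacian1 assms del: One_nat_def)
qed simp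

lemma inner1_laplacian_iter_limit:
  assumes "boundary X ori 1 h = (\<lambda>_. 0)" "boundary_transpose X ori 2 h = (\<lambda>_. 0)"
    and "\<And>e. (\<lambda>k. laplacian_iter X ori \<delta> y0 k e) \<longlonglongrightarrow> y e"
  shows "inner1 X y h = inner1 X y0 h"
proof -
  have "(\<lambda>k. inner1 X (laplacian_iter X ori \<delta> y0 k) h) \<longlonglongrightarrow> inner1 X y h"
    unfolding inner1_def by (intro tendsto_intros assms(3))
  thus ?thesis by (simp add: inner1_laplacian_iter[OF assms(1,2)] LIMSEQ_const_iff)
qed

section \<open>Linear forms in independent random variables\<close>

text \<open>By independence the joint distribution is a product measure. For fixed \<open>z\<close>
  only the single value \<open>-z\<close> of \<open>A\<close> is excluded, and Fubini gives the
  claim.\<close>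

lemma (in prob_space) AE_indep_add_neq_0:
  fixes A Z :: "'a \<Rightarrow> real"
  assumes indep: "indep_var borel A borel Z"
    and atomless: "\<And>a. AE x in distr M borel A. x \<noteq> a"
  shows "AE \<omega> in M. A \<omega> + Z \<omega> \<noteq> 0"
proof -
  have [measurable]: "A \<in> borel_measurable M" "Z \<in> borel_measurable M"
    using indep by (blast dest: indep_var_rv1 indep_var_rv2)+
  let ?A = "distr M borel A" and ?Z = "distr M borel Z"
  interpret A: prob_space ?A by (rule prob_space_distr) simp
  interpret Z: prob_space ?Z by (rule prob_space_distr) simp
  interpret AZ: pair_prob_space ?A ?Z ..
  have meas: "{x \<in> space (?A \<Otimes>\<^sub>M ?Z). fst x + snd x \<noteq> 0} \<in> sets (?A \<Otimes>\<^sub>M ?Z)"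
    by measurable
  have "AE z in ?Z. AE a in ?A. a + z \<noteq> 0"
    using atomless by (simp add: add_eq_0_iff2)
  \<comment> \<open>\<open>AE_pair_measure\<close> fixes the first coordinate, whereas the argument
    fixes the second.\<close>
  hence "AE a in ?A. AE z in ?Z. a + z \<noteq> 0"
    using AZ.AE_commute[OF meas] by simp
  hence "AE x in ?A \<Otimes>\<^sub>M ?Z. fst x + snd x \<noteq> 0"
    by (intro AZ.AE_pair_measure[OF meas]) simp
  hence "AE x in distr M (borel \<Otimes>\<^sub>M borel) (\<lambda>\<omega>. (A \<omega>, Z \<omega>)). fst x + snd x \<noteq> 0"
    using indep unfolding indep_var_distribution_eq by (elim conjE) (simp only:)
  thus ?thesis by (subst (asm) AE_distr_iff) auto
qed

text \<open>The term with the nonzero coefficient \<open>h j\<close> is atomless and independent of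
  the sum of the others.\<close>

lemma (in prob_space) AE_indep_linear_form_neq_0:
  fixes Y :: "'i \<Rightarrow> 'a \<Rightarrow> real"
  assumes "finite I" "indep_vars (\<lambda>_. borel) Y I"
    and atomless: "\<And>i a. i \<in> I \<Longrightarrow> AE x in distr M borel (Y i). x \<noteq> a"
    and j: "j \<in> I" "h j \<noteq> 0"
  shows "AE \<omega> in M. (\<Sum>i\<in>I. Y i \<omega> * h i) \<noteq> 0"
proof -
  have Y[measurable]: "Y j \<in> borel_measurable M" using assms(2) j by (auto simp: indep_vars_def)
  \<comment> \<open>\<open>indep_vars_sum\<close> expects the index set in this form.\<close>
  have I: "insert j (I - {j}) = I" using j by auto
  have "indep_vars (\<lambda>_. borel) (\<lambda>i \<omega>. Y i \<omega> * h i) I"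
    by (rule indep_vars_compose2[OF assms(2)]) simp
  hence "indep_var borel (\<lambda>\<omega>. Y j \<omega> * h j) borel (\<lambda>\<omega>. \<Sum>i\<in>I - {j}. Y i \<omega> * h i)"
    using assms(1) by (intro indep_vars_sum) (simp_all only: I finite_Diff, auto)
  moreover have "AE x in distr M borel (\<lambda>\<omega>. Y j \<omega> * h j). x \<noteq> a" for a
  proof -
    have "AE \<omega> in M. Y j \<omega> \<noteq> a / h j"
      using atomless[OF j(1)] by (subst (asm) AE_distr_iff) auto
    thus ?thesis using j(2) by (subst AE_distr_iff) (auto simp: field_simps)
  qed
  ultimately have "AE \<omega> in M. Y j \<omega> * h j + (\<Sum>i\<in>I - {j}. Y i \<omega> * h i) \<noteq> 0"
    by (rule AE_indep_add_neq_0)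
  thus ?thesis using assms(1) j(1) by (simp add: sum.remove)
qed

lemma AE_uniform_measure_lborel_neq: "AE x in uniform_measure lborel {a..b}. x \<noteq> (c::real)"
  using AE_lborel_singleton[of c] by (intro AE_uniform_measureI) auto

theorem corollary4p1:
  fixes X :: "'v set set" and ori :: "'v set \<Rightarrow> 'v list"
    and E\<^sub>T :: "'v set set" and r :: 'v and \<delta> :: real
    and M :: "'w measure" and y0 y :: "'w \<Rightarrow> 'v chain"
    and c1 c2 :: "'v chain"
  assumes "finite_simplicial_complex X"
    and "orientation X ori"
    and "graph_connected (vertices X) (edges X)"
    and "edges X \<noteq> {}"
    and "spanning_tree (vertices X) (edges X) E\<^sub>T"
    and "r \<in> vertices X"
    and "prob_space M"
    and "\<And>\<omega>. \<omega> \<in> space M \<Longrightarrow> y0 \<omega> \<in> chain_space X 1"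
    and "prob_space.indep_vars M (\<lambda>_. borel) (\<lambda>e \<omega>. y0 \<omega> e) (edges X)"
    and "\<And>e. e \<in> edges X \<Longrightarrow>
           distr M borel (\<lambda>\<omega>. y0 \<omega> e) = uniform_measure lborel {-1/2..1/2}"
    and "\<delta> > 0"
    and "\<And>\<mu>. laplacian1_eigenvalue X ori \<mu> \<Longrightarrow> \<mu> > 0 \<Longrightarrow> \<delta> < 2 / \<mu>"
    and "\<And>\<omega>. \<omega> \<in> space M \<Longrightarrow> y \<omega> \<in> harmonics X ori"
    and "\<And>\<omega> e. \<omega> \<in> space M \<Longrightarrow> (\<lambda>k. laplacian_iter X ori \<delta> (y0 \<omega>) k e) \<longlonglongrightarrow> y \<omega> e"
    and "c1 \<in> tree_cycles X ori E\<^sub>T r" and "c2 \<in> tree_cycles X ori E\<^sub>T r"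
  shows "AE \<omega> in M. homologous X ori c1 c2 \<longleftrightarrow>
           \<bar>inner1 X (y \<omega>) c1\<bar> = \<bar>inner1 X (y \<omega>) c2\<bar>"
proof -
  interpret prob_space M by fact
  note X = assms(1,2)
  note cyc = tree_cycles_are_cycles[OF X assms(5,6)]
  \<comment> \<open>This is applied below to the sum and the difference of \<open>c1\<close> and
    \<open>c2\<close>.\<close>
  have nz: "AE \<omega> in M. inner1 X (y \<omega>) c \<noteq> 0"
    if c: "c \<in> chain_space X 1" "boundary X ori 1 c = (\<lambda>_. 0)" "c \<notin> boundaries1 X ori" for c
  proof -
    obtain h x where x: "x \<in> chain_space X 2" and ch: "c = (\<lambda>e. h e + boundary X ori 2 x e)"
      and h: "h \<in> chain_space X 1" "boundary X ori 1 h = (\<lambda>_. 0)"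
        "boundary_transpose X ori 2 h = (\<lambda>_. 0)"
      using cycle_homologous_to_harmonic[OF X c(1,2)] .
    have "inner1 X (y \<omega>) c = (\<Sum>e\<in>edges X. y0 \<omega> e * h e)" if "\<omega> \<in> space M" for \<omega>
    proof -
      have "inner1 X (y \<omega>) c = inner1 X (y \<omega>) h"
        unfolding ch inner1_add_right
        using inner1_harmonic_boundary[OF assms(1) assms(13)[OF that]] by simp
      also have "\<dots> = inner1 X (y0 \<omega>) h"
        by (rule inner1_laplacian_iter_limit[OF h(2,3) assms(14)[OF that]])
      finally show ?thesis by (simp add: inner1_def)
    qed
    moreover have "AE \<omega> in M. (\<Sum>e\<in>edges X. y0 \<omega> e * h e) \<noteq> 0"
    proof -
      \<comment> \<open>If \<open>h\<close> were 0, then \<open>c\<close> would be the boundary of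
        \<open>x\<close>.\<close>
      have "h \<noteq> (\<lambda>_. 0)" using c(3) x ch by (auto simp: boundaries1_def)
      then obtain e where "h e \<noteq> 0" by auto
      moreover from this have "e \<in> edges X" using h(1) by (auto simp: chain_space_def)
      moreover have "AE x in distr M borel (\<lambda>\<omega>. y0 \<omega> e). x \<noteq> a" if "e \<in> edges X" for e a
        unfolding assms(10)[OF that] by (rule AE_uniform_measure_lborel_neq)
      ultimately show ?thesis
        by (intro AE_indep_linear_form_neq_0[OF finite_simplices[OF assms(1)] assms(9)])
    qed
    ultimately show ?thesis by (auto cong: AE_cong_simp)
  qed
  show ?thesis
  proof (cases "homologous X ori c1 c2")
    case True
    \<comment> \<open>In this direction the equality holds at every sample point.\<close>
    have "inner1 X (y \<omega>) c1 + inner1 X (y \<omega>) c2 = 0 \<or> inner1 X (y \<omega>) c1 - inner1 X (y \<omega>) c2 = 0"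
      if "\<omega> \<in> space M" for \<omega>
    proof -
      have "inner1 X (y \<omega>) b = 0" if "b \<in> boundaries1 X ori" for b
        using that inner1_harmonic_boundary[OF assms(1) assms(13)[OF \<open>\<omega> \<in> space M\<close>]]
        by (auto simp: boundaries1_def)
      thus ?thesis
        using True unfolding homologous_def inner1_add_right[symmetric] inner1_diff_right[symmetric]
        by blast
    qed
    hence "\<bar>inner1 X (y \<omega>) c1\<bar> = \<bar>inner1 X (y \<omega>) c2\<bar>" if "\<omega> \<in> space M" for \<omega>
      using that by fastforce
    with True show ?thesis by simp
  next
    case False
    \<comment> \<open>Equal absolute values would mean that the sum or the difference of the two
      products is 0; each is almost surely nonzero.\<close>
    have "AE \<omega> in M. inner1 X (y \<omega>) (\<lambda>e. c1 e + c2 e) \<noteq> 0"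
      using False cyc[OF assms(15)] cyc[OF assms(16)]
      by (intro nz) (auto simp: homologous_def chain_space_def boundary_add)
    moreover have "AE \<omega> in M. inner1 X (y \<omega>) (\<lambda>e. c1 e - c2 e) \<noteq> 0"
      using False cyc[OF assms(15)] cyc[OF assms(16)]
      by (intro nz) (auto simp: homologous_def chain_space_def boundary_diff)
    ultimately show ?thesis
      unfolding inner1_add_right inner1_diff_right
      by eventually_elim (use False in \<open>auto simp: abs_eq_iff\<close>)
  qed
qed

end
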